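(* A subset $A$ of $\mathbb{R}_F^c$ is relatively compact in $(\mathbb{R}_F^c, D)$ if and only if both of the following hold: (i) $A$ is bounded in $\mathbb{R}_F^c$, i.e. there exists a constant $M>0$ such that $D(u,0)\le M$ for all $u\in A$; (ii) $A$ is level-equicontinuous, i.e. for every $\varepsilon>0$ there exists $\delta>0$ such that for all $\alpha,\beta\in[0,1]$, if $|\alpha-\beta|<\delta$ then $\sup_{u\in A} d_H([u]^\alpha,[u]^\beta)<\varepsilon$.
   Context: $K_c(\mathbb{R})$ is the family of all nonempty, compact, convex subsets of $\mathbb{R}$, with the Hausdorff-Pompeiu metric $d_H(A,B)=\max\{\sup_{x\in A}\inf_{y\in B}|x-y|,\ \sup_{y\in B}\inf_{x\in A}|x-y|\}$. $\mathbb{R}_F$ (the space of fuzzy numbers on $\mathbb{R}$) is the set of all functions $u:\mathbb{R}\to[0,1]$ such that: (1) $u$ is normal: there is $t_0\in\mathbb{R}$ with $u(t_0)=1$; (2) $u$ is fuzzy convex: $u(\lambda t_1+(1-\lambda)t_2)\ge\min\{u(t_1),u(t_2)\}$ for all $t_1,t_2\in\mathbb{R}$, $\lambda\in[0,1]$; (3) $u$ is upper semicontinuous; (4) the closure of the support $\{t: u(t)>0\}$ is compact. For $u\in\mathbb{R}_F$ the level sets are $[u]^\alpha=\{t\in\mathbb{R}: u(t)\ge\alpha\}$ for $\alpha\in(0,1]$ and $[u]^0=\overline{\{t\in\mathbb{R}: u(t)>0\}}$; each $[u]^\alpha$ belongs to $K_c(\mathbb{R})$. The fuzzy null set $0\in\mathbb{R}_F$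 is the function equal to $1$ at $t=0$ and $0$ elsewhere. The metric on $\mathbb{R}_F$ is $D(u,v)=\sup_{\alpha\in[0,1]}d_H([u]^\alpha,[v]^\alpha)$. $\mathbb{R}_F^c$ is the set of $u\in\mathbb{R}_F$ such that the map $[0,1]\to K_c(\mathbb{R})$, $\alpha\mapsto[u]^\alpha$, is continuous; it carries the metric $D$. *)

theory Defs
  imports "HOL-Analysis.Analysis"
begin

definition Kc :: "real set set" where
  "Kc = {S. S \<noteq> {} \<and> compact S \<and> convex S}"

text \<open>
  The locale \<^locale>\<open>Metric_space\<close> demands nonnegativity and symmetry on the whole type, while real
  suprema of unbounded or empty sets are unspecified. Both metrics below are therefore set to 0
  outside their carriers.
\<close>

definition dH :: "real set \<Rightarrow> real set \<Rightarrow> real" where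
  "dH S T = (if S \<in> Kc \<and> T \<in> Kc
     then max (SUP x\<in>S. INF y\<in>T. \<bar>x - y\<bar>) (SUP y\<in>T. INF x\<in>S. \<bar>x - y\<bar>)
     else 0)"

definition upper_semicontinuous :: "(real \<Rightarrow> real) \<Rightarrow> bool" where
  "upper_semicontinuous u \<longleftrightarrow> (\<forall>t c. u t < c \<longrightarrow> (\<forall>\<^sub>F s in nhds t. u s < c))"

definition fuzzy_convex :: "(real \<Rightarrow> real) \<Rightarrow> bool" where
  "fuzzy_convex u \<longleftrightarrow>
     (\<forall>t1 t2. \<forall>l\<in>{0..1}. u (l * t1 + (1 - l) * t2) \<ge> min (u t1) (u t2))"

definition RF :: "(real \<Rightarrow> real) set" where
  "RF = {u. (\<forall>t. u t \<in> {0..1}) \<and> (\<exists>t0. u t0 = 1) \<and> fuzzy_convex u \<and>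
            upper_semicontinuous u \<and> compact (closure {t. u t > 0})}"

definition level :: "(real \<Rightarrow> real) \<Rightarrow> real \<Rightarrow> real set" where
  "level u \<alpha> = (if \<alpha> = 0 then closure {t. u t > 0} else {t. u t \<ge> \<alpha>})"

definition fuzzy_zero :: "real \<Rightarrow> real" where
  "fuzzy_zero = (\<lambda>t. if t = 0 then 1 else 0)"

definition D :: "(real \<Rightarrow> real) \<Rightarrow> (real \<Rightarrow> real) \<Rightarrow> real" where
  "D u v = (if u \<in> RF \<and> v \<in> RF then (SUP \<alpha>\<in>{0..1}. dH (level u \<alpha>) (level v \<alpha>)) else 0)"

definition RFc :: "(real \<Rightarrow> real) set" where
  "RFc = {u \<in> RF. continuous_map (top_of_set {0..1}) (Metric_space.mtopology Kc dH) (level u)}"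

definition relatively_compact_in :: "'a topology \<Rightarrow> 'a set \<Rightarrow> bool" where
  "relatively_compact_in X A \<longleftrightarrow> A \<subseteq> topspace X \<and> compactin X (X closure_of A)"

definition fuzzy_bounded :: "(real \<Rightarrow> real) set \<Rightarrow> bool" where
  "fuzzy_bounded A \<longleftrightarrow> (\<exists>M>0. \<forall>u\<in>A. D u fuzzy_zero \<le> M)"

text \<open>
  The supremum is taken in \<^typ>\<open>ennreal\<close>, where it is 0 for empty \<^term>\<open>A\<close> and infinite
  if the distances are unbounded.
\<close>

definition level_equicontinuous :: "(real \<Rightarrow> real) set \<Rightarrow> bool" where
  "level_equicontinuous A \<longleftrightarrow>
     (\<forall>\<epsilon>::real. \<epsilon> > 0 \<longrightarrow> (\<exists>\<delta>>0. \<forall>\<alpha>\<in>{0..1}. \<forall>\<beta>\<in>{0..1}. \<bar>\<alpha> - \<beta>\<bar> < \<delta> \<longrightarrow>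
        (SUP u\<in>A. ennreal (dH (level u \<alpha>) (level u \<beta>))) < ennreal \<epsilon>))"

lemma dH_le_iff:
  assumes S: "S \<in> Kc" and T: "T \<in> Kc"
  shows "dH S T \<le> r \<longleftrightarrow> (\<forall>x\<in>S. \<exists>y\<in>T. \<bar>x - y\<bar> \<le> r) \<and> (\<forall>y\<in>T. \<exists>x\<in>S. \<bar>x - y\<bar> \<le> r)"
proof -
  have *: "(SUP x\<in>P. INF y\<in>Q. \<bar>x - y\<bar>) \<le> r \<longleftrightarrow> (\<forall>x\<in>P. \<exists>y\<in>Q. \<bar>x - y\<bar> \<le> r)"
    if P: "P \<in> Kc" and Q: "Q \<in> Kc" for P Q
  proof -
    have ne: "P \<noteq> {}" "Q \<noteq> {}" and cp: "compact P" and cl: "closed Q"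
      using P Q by (auto simp: Kc_def compact_imp_closed)
    have inf: "(INF y\<in>Q. \<bar>x - y\<bar>) = infdist x Q" for x
      using ne by (simp add: infdist_def dist_real_def)
    have "compact ((\<lambda>x. infdist x Q) ` P)"
      by (intro compact_continuous_image cp continuous_intros)
    then have "bdd_above ((\<lambda>x. infdist x Q) ` P)"
      by (intro bounded_imp_bdd_above compact_imp_bounded)
    then have "(SUP x\<in>P. infdist x Q) \<le> r \<longleftrightarrow> (\<forall>x\<in>P. infdist x Q \<le> r)"
      using ne by (simp add: cSUP_le_iff)
    moreover have "infdist x Q \<le> r \<longleftrightarrow> (\<exists>y\<in>Q. \<bar>x - y\<bar> \<le> r)" for x
    proof
      assume "infdist x Q \<le> r"
      moreover obtain y where "y \<in> Q" "infdist x Q = dist x y"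
        using infdist_attains_inf[OF cl ne(2)] by blast
      ultimately show "\<exists>y\<in>Q. \<bar>x - y\<bar> \<le> r"
        by (auto simp: dist_real_def)
    next
      assume "\<exists>y\<in>Q. \<bar>x - y\<bar> \<le> r"
      then show "infdist x Q \<le> r"
        by (auto simp: dist_real_def intro: infdist_le2)
    qed
    ultimately show ?thesis
      by (simp add: inf)
  qed
  show ?thesis
    using *[OF S T] *[OF T S] S T by (simp add: dH_def abs_minus_commute)
qed

lemma dH_nonneg: "0 \<le> dH S T"
proof (cases "S \<in> Kc \<and> T \<in> Kc")
  case True
  then obtain x where "x \<in> S"
    by (auto simp: Kc_def)
  moreover have "\<forall>x\<in>S. \<exists>y\<in>T. \<bar>x - y\<bar> \<le> dH S T"
    using dH_le_iff[of S T "dH S T"] True by blast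
  ultimately obtain y where "\<bar>x - y\<bar> \<le> dH S T"
    by blast
  then show ?thesis
    by linarith
qed (auto simp: dH_def)

lemma dH_commute: "dH S T = dH T S"
  by (auto simp: dH_def abs_minus_commute max.commute)

lemma Metric_space_Kc: "Metric_space Kc dH"
proof
  fix S T U :: "real set"
  show "0 \<le> dH S T" "dH S T = dH T S"
    by (rule dH_nonneg dH_commute)+
  assume ST: "S \<in> Kc" "T \<in> Kc"
  have "dH S T = 0 \<longleftrightarrow> dH S T \<le> 0"
    using dH_nonneg[of S T] by linarith
  also have "\<dots> \<longleftrightarrow> S = T"
    unfolding dH_le_iff[OF ST] by auto
  finally show "dH S T = 0 \<longleftrightarrow> S = T" .
  assume U: "U \<in> Kc"
  have tri: "\<bar>x - z\<bar> \<le> dH S T + dH T U"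
    if "\<bar>x - y\<bar> \<le> dH S T" "\<bar>y - z\<bar> \<le> dH T U" for x y z :: real
    using that by linarith
  have "\<forall>x\<in>S. \<exists>y\<in>T. \<bar>x - y\<bar> \<le> dH S T" "\<forall>y\<in>T. \<exists>x\<in>S. \<bar>x - y\<bar> \<le> dH S T"
    "\<forall>y\<in>T. \<exists>z\<in>U. \<bar>y - z\<bar> \<le> dH T U" "\<forall>z\<in>U. \<exists>y\<in>T. \<bar>y - z\<bar> \<le> dH T U"
    using dH_le_iff[OF ST, of "dH S T"] dH_le_iff[OF ST(2) U, of "dH T U"] by blast+
  then show "dH S U \<le> dH S T + dH T U"
    unfolding dH_le_iff[OF ST(1) U] by (meson tri)
qed

lemma level_subset: "0 \<le> \<alpha> \<Longrightarrow> level u \<alpha> \<subseteq> level u 0"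
proof
  fix t
  assume "0 \<le> \<alpha>" "t \<in> level u \<alpha>"
  then have "t \<in> level u 0 \<or> t \<in> {t. u t > 0}"
    by (cases "\<alpha> = 0") (simp_all add: level_def)
  then show "t \<in> level u 0"
    unfolding level_def if_P[OF refl] using closure_subset[of "{t. u t > 0}"] by blast
qed

lemma level_in_Kc:
  assumes u: "u \<in> RF" and \<alpha>: "\<alpha> \<in> {0..1}"
  shows "level u \<alpha> \<in> Kc"
proof -
  from u obtain t0 where t0: "u t0 = 1"
    by (auto simp: RF_def)
  have conv: "u (l * s + m * t) \<ge> min (u s) (u t)" if "l \<ge> 0" "m \<ge> 0" "l + m = 1" for l m s t
  proof -
    have "m = 1 - l" "l \<in> {0..1}"
      using that by auto
    then show ?thesis
      using u by (auto simp: RF_def fuzzy_convex_def)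
  qed
  have cpt: "compact (closure {t. u t > 0})"
    using u by (simp add: RF_def)
  show ?thesis
  proof (cases "\<alpha> = 0")
    case True
    have cvx: "convex {t. u t > 0}"
    proof (rule convexI)
      fix s t l m :: real
      assume "s \<in> {t. u t > 0}" "t \<in> {t. u t > 0}" "0 \<le> l" "0 \<le> m" "l + m = 1"
      then show "l *\<^sub>R s + m *\<^sub>R t \<in> {t. u t > 0}"
        using conv[of l m s t] by simp
    qed
    have "{t. u t > 0} \<noteq> {}"
      using t0 by (metis empty_Collect_eq zero_less_one)
    then have "closure {t. u t > 0} \<in> Kc"
      unfolding Kc_def mem_Collect_eq closure_eq_empty using cpt convex_closure[OF cvx] by simp
    then show ?thesis
      using True by (simp add: level_def)
  next
    case False
    have "open {t. u t < \<alpha>}"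
      using u by (simp add: RF_def upper_semicontinuous_def eventually_nhds
          open_subopen[of "{t. u t < \<alpha>}"] subset_eq)
    moreover have "- {t. u t < \<alpha>} = {t. \<alpha> \<le> u t}"
      by auto
    ultimately have "closed (level u \<alpha>)"
      using False by (simp add: level_def closed_def Collect_neg_eq[symmetric] not_le)
    then have "compact (level u 0 \<inter> level u \<alpha>)"
      using cpt by (intro compact_Int_closed) (simp_all add: level_def)
    then have "compact (level u \<alpha>)"
      using level_subset[of \<alpha> u] \<alpha> by (simp add: Int_absorb1)
    moreover have "convex (level u \<alpha>)"
    proof (rule convexI)
      fix s t l m :: real
      assume "s \<in> level u \<alpha>" "t \<in> level u \<alpha>" "0 \<le> l" "0 \<le> m" "l + m = 1"
      then show "l *\<^sub>R s + m *\<^sub>R t \<in> level u \<alpha>"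
        using conv[of l m s t] False by (simp add: level_def)
    qed
    moreover have "t0 \<in> level u \<alpha>"
      using t0 \<alpha> False by (simp add: level_def)
    ultimately show ?thesis
      by (auto simp: Kc_def)
  qed
qed

lemma D_le_iff:
  assumes u: "u \<in> RF" and v: "v \<in> RF"
  shows "D u v \<le> r \<longleftrightarrow> (\<forall>\<alpha>\<in>{0..1}. dH (level u \<alpha>) (level v \<alpha>) \<le> r)"
proof -
  have "bounded (level u 0 \<union> level v 0)"
    using level_in_Kc[OF u, of 0] level_in_Kc[OF v, of 0] by (auto simp: Kc_def compact_imp_bounded)
  then obtain K where K: "\<And>x. x \<in> level u 0 \<union> level v 0 \<Longrightarrow> \<bar>x\<bar> \<le> K"
    by (auto simp: bounded_iff)
  have "dH (level u \<alpha>) (level v \<alpha>) \<le> 2 * K" if \<alpha>: "\<alpha> \<in> {0..1}" for \<alpha>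
  proof -
    have "level u \<alpha> \<noteq> {}" "level v \<alpha> \<noteq> {}"
      using level_in_Kc[OF u \<alpha>] level_in_Kc[OF v \<alpha>] by (auto simp: Kc_def)
    moreover have "\<bar>x - y\<bar> \<le> 2 * K" if "x \<in> level u \<alpha>" "y \<in> level v \<alpha>" for x y
    proof -
      have "x \<in> level u 0" "y \<in> level v 0"
        using that level_subset[of \<alpha>] \<alpha> by (meson atLeastAtMost_iff subsetD)+
      then have "\<bar>x\<bar> \<le> K" "\<bar>y\<bar> \<le> K"
        by (simp_all add: K)
      then show ?thesis
        by linarith
    qed
    ultimately show ?thesis
      unfolding dH_le_iff[OF level_in_Kc[OF u \<alpha>] level_in_Kc[OF v \<alpha>]] by blast
  qed
  then have "bdd_above ((\<lambda>\<alpha>. dH (level u \<alpha>) (level v \<alpha>)) ` {0..1})"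
    by (rule bdd_aboveI2)
  then show ?thesis
    using u v by (simp add: D_def cSUP_le_iff)
qed

lemma RF_eqI:
  assumes u: "u \<in> RF" and v: "v \<in> RF" and eq: "\<And>\<alpha>. \<alpha> \<in> {0..1} \<Longrightarrow> level u \<alpha> = level v \<alpha>"
  shows "u = v"
proof -
  have le: "f t \<le> g t"
    if "f \<in> RF" "g \<in> RF" "\<And>\<alpha>. \<alpha> \<in> {0..1} \<Longrightarrow> level f \<alpha> = level g \<alpha>" for f g t
  proof (cases "f t = 0")
    case True
    then show ?thesis
      using that(2) by (simp add: RF_def)
  next
    case False
    have "f t \<in> {0..1}"
      using that(1) unfolding RF_def by blast
    then have "level f (f t) = level g (f t)"
      by (rule that)
    moreover have "t \<in> level f (f t)"
      using False by (simp add: level_def)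
    ultimately show ?thesis
      using False by (simp add: level_def)
  qed
  show ?thesis
  proof
    fix t
    show "u t = v t"
      using le[OF u v eq, of t] le[OF v u eq[symmetric], of t] by (rule order_antisym)
  qed
qed

lemma D_nonneg: "0 \<le> D u v"
proof (cases "u \<in> RF \<and> v \<in> RF")
  case True
  then have "dH (level u 0) (level v 0) \<le> D u v"
    using D_le_iff[of u v "D u v"] by (meson atLeastAtMost_iff order_refl zero_le_one)
  then show ?thesis
    by (rule order_trans[OF dH_nonneg])
qed (auto simp: D_def)

lemma Metric_space_RF: "Metric_space RF D"
proof
  interpret Kc: Metric_space Kc dH
    by (rule Metric_space_Kc)
  fix u v w :: "real \<Rightarrow> real"
  show "0 \<le> D u v"
    by (rule D_nonneg)
  have "(\<lambda>\<alpha>. dH (level u \<alpha>) (level v \<alpha>)) = (\<lambda>\<alpha>. dH (level v \<alpha>) (level u \<alpha>))"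
    by (intro ext dH_commute)
  then show "D u v = D v u"
    unfolding D_def by metis
  assume uv: "u \<in> RF" "v \<in> RF"
  have "D u v = 0 \<longleftrightarrow> D u v \<le> 0"
    using D_nonneg[of u v] by auto
  also have "\<dots> \<longleftrightarrow> (\<forall>\<alpha>\<in>{0..1}. level u \<alpha> = level v \<alpha>)"
    unfolding D_le_iff[OF uv]
  proof (intro ball_cong refl)
    fix \<alpha> :: real
    assume \<alpha>: "\<alpha> \<in> {0..1}"
    show "dH (level u \<alpha>) (level v \<alpha>) \<le> 0 \<longleftrightarrow> level u \<alpha> = level v \<alpha>"
      using Kc.zero[OF level_in_Kc[OF uv(1) \<alpha>] level_in_Kc[OF uv(2) \<alpha>]]
        dH_nonneg[of "level u \<alpha>" "level v \<alpha>"] by linarith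
  qed
  also have "\<dots> \<longleftrightarrow> u = v"
    using RF_eqI[OF uv] by blast
  finally show "D u v = 0 \<longleftrightarrow> u = v" .
  assume w: "w \<in> RF"
  show "D u w \<le> D u v + D v w"
    unfolding D_le_iff[OF uv(1) w]
  proof
    fix \<alpha> :: real
    assume \<alpha>: "\<alpha> \<in> {0..1}"
    have "dH (level u \<alpha>) (level w \<alpha>) \<le> dH (level u \<alpha>) (level v \<alpha>) + dH (level v \<alpha>) (level w \<alpha>)"
      using uv w \<alpha> by (intro Kc.triangle level_in_Kc)
    also have "\<dots> \<le> D u v + D v w"
      using D_le_iff[OF uv, of "D u v"] D_le_iff[OF uv(2) w, of "D v w"] \<alpha>
      by (intro add_mono) blast+
    finally show "dH (level u \<alpha>) (level w \<alpha>) \<le> D u v + D v w" .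
  qed
qed

lemma Metric_space_RFc: "Metric_space RFc D"
  by (rule Metric_space.subspace[OF Metric_space_RF]) (simp add: RFc_def)

lemma fuzzy_zero_in_RFc: "fuzzy_zero \<in> RFc"
proof -
  interpret Kc: Metric_space Kc dH
    by (rule Metric_space_Kc)
  have supp: "{t. fuzzy_zero t > 0} = {0}"
    by (auto simp: fuzzy_zero_def)
  have "\<forall>\<^sub>F s in nhds t. fuzzy_zero s < c" if "fuzzy_zero t < c" for t c
  proof (cases "t = 0")
    case True
    then have "fuzzy_zero s < c" for s
      using that by (simp add: fuzzy_zero_def split: if_splits)
    then show ?thesis
      by simp
  next
    case False
    then have "\<forall>\<^sub>F s in nhds t. s \<noteq> 0"
      by (intro t1_space_nhds)
    then show ?thesis
      by eventually_elim (use that False in \<open>simp add: fuzzy_zero_def\<close>)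
  qed
  then have "upper_semicontinuous fuzzy_zero"
    by (simp add: upper_semicontinuous_def)
  moreover have "fuzzy_convex fuzzy_zero"
    unfolding fuzzy_convex_def
  proof (intro allI ballI)
    fix t1 t2 l :: real
    show "min (fuzzy_zero t1) (fuzzy_zero t2) \<le> fuzzy_zero (l * t1 + (1 - l) * t2)"
      by (cases "t1 = 0 \<and> t2 = 0") (auto simp: fuzzy_zero_def)
  qed
  ultimately have RF: "fuzzy_zero \<in> RF"
    by (auto simp: RF_def supp) (auto simp: fuzzy_zero_def)
  have lev: "level fuzzy_zero \<alpha> = {0}" if "\<alpha> \<in> {0..1}" for \<alpha>
    using that by (auto simp: level_def supp) (auto simp: fuzzy_zero_def split: if_splits)
  have "continuous_map (top_of_set {0..1}) Kc.mtopology (level fuzzy_zero)"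
  proof (rule continuous_map_eq)
    have "{0} \<in> Kc"
      by (simp add: Kc_def)
    then show "continuous_map (top_of_set {0..1}) Kc.mtopology (\<lambda>_::real. {0})"
      by simp
  qed (simp add: lev)
  with RF show ?thesis
    by (simp add: RFc_def)
qed

end

theory Submission
  imports Defs "HOL-Complex_Analysis.Great_Picard"
begin

text \<open>
  A level set is a compact interval, so a fuzzy number is encoded by the curve of the endpoints of
  its level sets in the plane, and up to a factor 2 the metric \<^const>\<open>D\<close> is the uniform distance
  of these curves. Conversely every continuous nested family of intervals is the family of level
  sets of an element of \<^const>\<open>RFc\<close>. So the set of curves is closed under uniform limits, and the
  theorem of Arzela and Ascoli yields sufficiency; necessity follows from total boundedness.
\<close>

section \<open>Level sets as intervals and the Hausdorff metric in terms of endpoints\<close>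

definition endpoints :: "(real \<Rightarrow> real) \<Rightarrow> real \<Rightarrow> real \<times> real" where
  "endpoints u \<alpha> = (Inf (level u \<alpha>), Sup (level u \<alpha>))"

lemma interval_in_Kc: "a \<le> b \<Longrightarrow> {a..b} \<in> Kc"
  by (simp add: Kc_def)

lemma Kc_eq_interval:
  assumes "S \<in> Kc"
  shows "S = {Inf S..Sup S}" "Inf S \<le> Sup S"
proof -
  have S: "S \<noteq> {}" "compact S" "connected S"
    using assms by (auto simp: Kc_def convex_connected)
  then obtain a b where "S = {a..b}"
    using connected_compact_interval_1 by (metis cbox_interval)
  with S show "S = {Inf S..Sup S}" "Inf S \<le> Sup S"
    by auto
qed

text \<open>In one direction, a point of the second interval near \<open>a\<close> bounds
  \<open>c\<close> from above, and a point of the first near \<open>c\<close> bounds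
  \<open>a\<close> from above; the right endpoints are symmetric. In the other, clamping a point to
  the other interval moves it by at most r.\<close>

lemma dH_interval_le_iff:
  assumes "a \<le> b" "c \<le> d"
  shows "dH {a..b} {c..d} \<le> r \<longleftrightarrow> \<bar>a - c\<bar> \<le> r \<and> \<bar>b - d\<bar> \<le> r"
proof -
  \<comment> \<open>The witness is the point of \<open>{c..d}\<close> nearest to x. If x < c, its
    distance c - x is at most c - a because x lies to the right of \<open>a\<close>; the case x > d
    is symmetric.\<close>
  have near: "\<exists>y\<in>{c..d}. \<bar>x - y\<bar> \<le> r"
    if "\<bar>a - c\<bar> \<le> r" "\<bar>b - d\<bar> \<le> r" "x \<in> {a..b}" "c \<le> d" for a b c d x :: real
    using that by (intro bexI[of _ "max c (min x d)"]) (auto simp: max_def min_def)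
  show ?thesis
    unfolding dH_le_iff[OF interval_in_Kc[OF assms(1)] interval_in_Kc[OF assms(2)]]
  proof safe
    assume l: "\<forall>x\<in>{a..b}. \<exists>y\<in>{c..d}. \<bar>x - y\<bar> \<le> r" and r: "\<forall>y\<in>{c..d}. \<exists>x\<in>{a..b}. \<bar>x - y\<bar> \<le> r"
    obtain y where "y \<in> {c..d}" "\<bar>a - y\<bar> \<le> r"
      using l assms by force
    moreover obtain x where "x \<in> {a..b}" "\<bar>x - c\<bar> \<le> r"
      using r assms by force
    ultimately show "\<bar>a - c\<bar> \<le> r"
      by auto
    obtain y where "y \<in> {c..d}" "\<bar>b - y\<bar> \<le> r"
      using l assms by force
    moreover obtain x where "x \<in> {a..b}" "\<bar>x - d\<bar> \<le> r"
      using r assms by force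
    ultimately show "\<bar>b - d\<bar> \<le> r"
      by auto
  next
    fix x assume "\<bar>a - c\<bar> \<le> r" "\<bar>b - d\<bar> \<le> r" "x \<in> {a..b}"
    then show "\<exists>y\<in>{c..d}. \<bar>x - y\<bar> \<le> r"
      using near assms(2) by blast
  next
    fix y assume "\<bar>a - c\<bar> \<le> r" "\<bar>b - d\<bar> \<le> r" "y \<in> {c..d}"
    then show "\<exists>x\<in>{a..b}. \<bar>x - y\<bar> \<le> r"
      using near[of c a d b y] assms(1) by (simp add: abs_minus_commute)
  qed
qed

lemma level_eq_interval:
  assumes "u \<in> RF" "\<alpha> \<in> {0..1}"
  shows "level u \<alpha> = {fst (endpoints u \<alpha>)..snd (endpoints u \<alpha>)}"
    and "fst (endpoints u \<alpha>) \<le> snd (endpoints u \<alpha>)"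
  using Kc_eq_interval[OF level_in_Kc[OF assms]] by (simp_all add: endpoints_def)

text \<open>Both the fuzzy number and the level may vary: equal levels give the estimates for
  \<open>D\<close>, equal fuzzy numbers those for continuity in the level.\<close>

lemma dH_level_le_iff:
  assumes "u \<in> RF" "\<alpha> \<in> {0..1}" "v \<in> RF" "\<beta> \<in> {0..1}"
  shows "dH (level u \<alpha>) (level v \<beta>) \<le> r \<longleftrightarrow>
    \<bar>fst (endpoints u \<alpha>) - fst (endpoints v \<beta>)\<bar> \<le> r \<and>
    \<bar>snd (endpoints u \<alpha>) - snd (endpoints v \<beta>)\<bar> \<le> r"
  using dH_interval_le_iff level_eq_interval assms by metis

lemma dH_level_le_dist:
  assumes "u \<in> RF" "\<alpha> \<in> {0..1}" "v \<in> RF" "\<beta> \<in> {0..1}"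
  shows "dH (level u \<alpha>) (level v \<beta>) \<le> dist (endpoints u \<alpha>) (endpoints v \<beta>)"
  unfolding dH_level_le_iff[OF assms]
  using dist_fst_le[of "endpoints u \<alpha>" "endpoints v \<beta>"] dist_snd_le[of "endpoints u \<alpha>" "endpoints v \<beta>"]
  by (simp add: dist_real_def)

text \<open>The Euclidean distance is at most the sum of the two coordinate distances, and
  \<open>dH\<close> bounds each of them. The factor 2 is not optimal but harmless for convergence
  and continuity.\<close>

lemma dist_le_dH_level:
  assumes "u \<in> RF" "\<alpha> \<in> {0..1}" "v \<in> RF" "\<beta> \<in> {0..1}"
  shows "dist (endpoints u \<alpha>) (endpoints v \<beta>) \<le> 2 * dH (level u \<alpha>) (level v \<beta>)"
proof -
  have "dist (endpoints u \<alpha>) (endpoints v \<beta>) \<le>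
      \<bar>fst (endpoints u \<alpha>) - fst (endpoints v \<beta>)\<bar> + \<bar>snd (endpoints u \<alpha>) - snd (endpoints v \<beta>)\<bar>"
    unfolding dist_prod_def dist_real_def
    using sqrt_sum_squares_le_sum_abs by (metis power2_abs)
  also have "\<dots> \<le> 2 * dH (level u \<alpha>) (level v \<beta>)"
    using dH_level_le_iff[OF assms, of "dH (level u \<alpha>) (level v \<beta>)"] by simp
  finally show ?thesis .
qed

section \<open>Continuity of the level map and of the endpoint curve\<close>

text \<open>Brings the abstract continuity in the definition of \<open>RFc\<close> into an
  epsilon-delta form that can be compared with \<open>continuous_on_iff\<close>. Membership in
  \<open>M\<close> appears separately because bounds on \<open>d\<close> alone do not imply
  it.\<close>

lemma (in Metric_space) continuous_map_top_of_set_iff: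
  fixes S :: "'b::metric_space set"
  shows "continuous_map (top_of_set S) mtopology f \<longleftrightarrow> f \<in> S \<rightarrow> M \<and>
    (\<forall>x\<in>S. \<forall>\<epsilon>>0. \<exists>\<delta>>0. \<forall>y\<in>S. dist y x < \<delta> \<longrightarrow> d (f x) (f y) < \<epsilon>)"
  (is "?L \<longleftrightarrow> ?R")
proof
  assume L: ?L
  have "\<exists>\<delta>>0. \<forall>y\<in>S. dist y x < \<delta> \<longrightarrow> d (f x) (f y) < \<epsilon>" if "x \<in> S" "\<epsilon> > 0" for x \<epsilon>
  proof -
    have "x \<in> topspace (top_of_set S)"
      using that by simp
    then obtain U where U: "openin (top_of_set S) U" "x \<in> U" "\<forall>y\<in>U. f y \<in> mball (f x) \<epsilon>"
      using L[unfolded continuous_map_to_metric] \<open>\<epsilon> > 0\<close> by blast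
    then obtain \<delta> where \<delta>: "\<delta> > 0" "\<forall>y\<in>S. dist y x < \<delta> \<longrightarrow> y \<in> U"
      unfolding openin_euclidean_subtopology_iff by blast
    then have "\<forall>y\<in>S. dist y x < \<delta> \<longrightarrow> d (f x) (f y) < \<epsilon>"
      using U(3) by (meson in_mball)
    with \<delta>(1) show ?thesis
      by blast
  qed
  moreover have "f \<in> S \<rightarrow> M"
    using continuous_map_image_subset_topspace[OF L] by auto
  ultimately show ?R
    by blast
next
  assume R: ?R
  show ?L
    unfolding continuous_map_to_metric
  proof (intro ballI allI impI)
    fix x and \<epsilon> :: real
    assume "x \<in> topspace (top_of_set S)" and e: "0 < \<epsilon>"
    then have x: "x \<in> S"
      by simp
    obtain \<delta> where d: "\<delta> > 0" "\<forall>y\<in>S. dist y x < \<delta> \<longrightarrow> d (f x) (f y) < \<epsilon>"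
      using R x e by blast
    show "\<exists>U. openin (top_of_set S) U \<and> x \<in> U \<and> (\<forall>y\<in>U. f y \<in> mball (f x) \<epsilon>)"
    proof (intro exI conjI)
      show "openin (top_of_set S) (S \<inter> ball x \<delta>)"
        by (simp add: openin_open_Int)
      show "\<forall>y\<in>S \<inter> ball x \<delta>. f y \<in> mball (f x) \<epsilon>"
      proof
        fix y assume "y \<in> S \<inter> ball x \<delta>"
        then have y: "y \<in> S" "dist y x < \<delta>"
          by (simp_all add: dist_commute)
        have "f x \<in> M" "f y \<in> M"
          using R x y(1) by (simp_all add: Pi_iff)
        with d(2) y show "f y \<in> mball (f x) \<epsilon>"
          unfolding in_mball by blast
      qed
    qed (use x d in auto)
  qed
qed

text \<open>Distances of level sets and of endpoint pairs bound each other up to the factor 2, so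
  continuity means the same for both. Halving e absorbs the factor.\<close>

lemma RFc_iff_continuous_endpoints:
  "u \<in> RFc \<longleftrightarrow> u \<in> RF \<and> continuous_on {0..1} (endpoints u)"
proof -
  interpret Kc: Metric_space Kc dH
    by (rule Metric_space_Kc)
  have "(\<forall>x\<in>{0..1}. \<forall>\<epsilon>>0. \<exists>\<delta>>0. \<forall>y\<in>{0..1}. dist y x < \<delta> \<longrightarrow> dH (level u x) (level u y) < \<epsilon>)
      \<longleftrightarrow> continuous_on {0..1} (endpoints u)" (is "?L \<longleftrightarrow> ?R") if u: "u \<in> RF"
  proof
    assume L: ?L
    show ?R
      unfolding continuous_on_iff
    proof (intro ballI allI impI)
      fix x e :: real
      assume x: "x \<in> {0..1}" and "0 < e"
      then obtain \<delta> where d: "\<delta> > 0" "\<forall>y\<in>{0..1}. dist y x < \<delta> \<longrightarrow> dH (level u x) (level u y) < e / 2"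
        using L[rule_format, of x "e / 2"] by auto
      have "dist (endpoints u y) (endpoints u x) < e" if "y \<in> {0..1}" "dist y x < \<delta>" for y
        using d(2) that dist_le_dH_level[OF u x u that(1)] by (fastforce simp: dist_commute)
      then show "\<exists>d>0. \<forall>y\<in>{0..1}. dist y x < d \<longrightarrow> dist (endpoints u y) (endpoints u x) < e"
        using d(1) by blast
    qed
  next
    assume R: ?R
    show ?L
    proof (intro ballI allI impI)
      fix x e :: real
      assume x: "x \<in> {0..1}" and "0 < e"
      then obtain \<delta> where d: "\<delta> > 0"
          "\<forall>y\<in>{0..1}. dist y x < \<delta> \<longrightarrow> dist (endpoints u y) (endpoints u x) < e"
        using R[unfolded continuous_on_iff] by blast
      have "dH (level u x) (level u y) < e" if "y \<in> {0..1}" "dist y x < \<delta>" for y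
        using d(2) that dH_level_le_dist[OF u x u that(1)] by (fastforce simp: dist_commute)
      then show "\<exists>d>0. \<forall>y\<in>{0..1}. dist y x < d \<longrightarrow> dH (level u x) (level u y) < e"
        using d(1) by blast
    qed
  qed
  then show ?thesis
    by (auto simp: RFc_def Kc.continuous_map_top_of_set_iff level_in_Kc)
qed

section \<open>Fuzzy numbers from nested families of intervals\<close>

text \<open>The value of \<open>u\<close> at t is the greatest level whose interval contains t.
  Continuity does two jobs: it makes the set of these levels closed, so that the supremum is
  attained, and it makes the interval at 0 the closure of the union of those at positive levels, as
  \<open>level u 0\<close> demands.\<close>

lemma RF_of_continuous_intervals:
  fixes l r :: "real \<Rightarrow> real"
  assumes l: "continuous_on {0..1} l" and r: "continuous_on {0..1} r"
    and ml: "mono_on {0..1} l" and mr: "antimono_on {0..1} r"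
    and le: "\<And>\<alpha>. \<alpha> \<in> {0..1} \<Longrightarrow> l \<alpha> \<le> r \<alpha>"
  obtains u where "u \<in> RF" "\<And>\<alpha>. \<alpha> \<in> {0..1} \<Longrightarrow> level u \<alpha> = {l \<alpha>..r \<alpha>}"
proof -
  define P where "P t = {\<alpha>\<in>{0..1}. l \<alpha> \<le> t \<and> t \<le> r \<alpha>}" for t
  \<comment> \<open>The supremum of the empty set of reals is unspecified, so points outside all
    intervals get the value 0 explicitly.\<close>
  define u where "u t = (if P t = {} then 0 else Sup (P t))" for t
  have mono: "l s \<le> l t" "r t \<le> r s" if "s \<in> {0..1}" "t \<in> {0..1}" "s \<le> t" for s t
    using that monotone_onD[OF ml] monotone_onD[OF mr] by blast+
  have clP: "closed (P t)" for t
  proof -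
    have "closed (({0..1} \<inter> l -` {..t}) \<inter> ({0..1} \<inter> r -` {t..}))"
      by (rule closed_Int[OF continuous_closed_preimage[OF l] continuous_closed_preimage[OF r]])
        simp_all
    also have "({0..1} \<inter> l -` {..t}) \<inter> ({0..1} \<inter> r -` {t..}) = P t"
      by (auto simp: P_def)
    finally show ?thesis .
  qed
  have bdd: "bdd_above (P t)" for t
    by (rule bdd_aboveI[of _ 1]) (auto simp: P_def)
  have attained: "u t \<in> P t" if "P t \<noteq> {}" for t
    using closed_contains_Sup[OF that bdd clP] that by (simp add: u_def)
  have range: "u t \<in> {0..1}" for t
    using attained[of t] by (cases "P t = {}") (auto simp: u_def P_def)
  \<comment> \<open>Level 0 is excluded: every t satisfies \<open>0 \<le> u t\<close>, whereas the
    interval at 0 is bounded.\<close>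
  have ge_iff: "\<alpha> \<le> u t \<longleftrightarrow> t \<in> {l \<alpha>..r \<alpha>}" if \<alpha>: "\<alpha> \<in> {0<..1}" for \<alpha> t
  proof
    assume ge: "\<alpha> \<le> u t"
    with \<alpha> have "P t \<noteq> {}"
      by (auto simp: u_def)
    \<comment> \<open>The interval at level \<open>u t\<close> contains t and, by nestedness, lies
      inside the interval at the lower level \<alpha>.\<close>
    from attained[OF this] show "t \<in> {l \<alpha>..r \<alpha>}"
      using mono[of \<alpha> "u t"] ge \<alpha> by (auto simp: P_def)
  next
    assume "t \<in> {l \<alpha>..r \<alpha>}"
    then have "\<alpha> \<in> P t"
      using \<alpha> by (auto simp: P_def)
    then show "\<alpha> \<le> u t"
      using cSup_upper[OF _ bdd] by (auto simp: u_def)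
  qed
  have supp: "{t. u t > 0} \<subseteq> {l 0..r 0}"
  proof
    fix t assume "t \<in> {t. u t > 0}"
    then have "u t > 0" "t \<in> {l (u t)..r (u t)}"
      using ge_iff[of "u t" t] range[of t] by auto
    then show "t \<in> {l 0..r 0}"
      using mono[of 0 "u t"] range[of t] by auto
  qed
  have cl_supp: "closure {t. u t > 0} = {l 0..r 0}"
  proof
    show "closure {t. u t > 0} \<subseteq> {l 0..r 0}"
      using supp by (rule closure_minimal) simp
    show "{l 0..r 0} \<subseteq> closure {t. u t > 0}"
    proof
      fix t assume t: "t \<in> {l 0..r 0}"
      define a where "a n = inverse (real (Suc n))" for n
      have a: "a n \<in> {0<..1}" for n
        by (auto simp: a_def field_simps)
      have lim: "(\<lambda>n. f (a n)) \<longlonglongrightarrow> f 0" if "continuous_on {0..1} f" for f :: "real \<Rightarrow> real"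
      proof (rule continuous_on_tendsto_compose[OF that])
        show "a \<longlonglongrightarrow> 0"
          unfolding a_def by (rule LIMSEQ_inverse_real_of_nat)
      qed (use a in \<open>auto simp: less_imp_le\<close>)
      \<comment> \<open>Clamping t to the interval at the positive level \<open>a n\<close> gives a
        point of the support. By continuity at 0 these points tend to t clamped to
        \<open>{l 0..r 0}\<close>, which is t itself.\<close>
      define s where "s n = max (l (a n)) (min t (r (a n)))" for n
      have "s \<longlonglongrightarrow> max (l 0) (min t (r 0))"
        unfolding s_def by (intro tendsto_intros lim l r)
      also have "max (l 0) (min t (r 0)) = t"
        using t by auto
      finally have "s \<longlonglongrightarrow> t" .
      moreover have "s n \<in> {t. u t > 0}" for n
      proof -
        have "s n \<in> {l (a n)..r (a n)}"
          using le[of "a n"] a[of n] by (auto simp: s_def)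
        then show ?thesis
          using ge_iff[OF a, of n "s n"] a[of n] by auto
      qed
      ultimately show "t \<in> closure {t. u t > 0}"
        unfolding closure_sequential by blast
    qed
  qed
  have conv: "fuzzy_convex u"
    unfolding fuzzy_convex_def
  proof (intro allI ballI)
    fix t1 t2 c :: real
    assume c: "c \<in> {0..1}"
    define m where "m = min (u t1) (u t2)"
    show "min (u t1) (u t2) \<le> u (c * t1 + (1 - c) * t2)"
    \<comment> \<open>For positive m the claim is convexity of the interval at level m; the value 0
      is split off because \<open>ge_iff\<close> does not cover it.\<close>
    proof (cases "m = 0")
      case True
      then show ?thesis
        using range[of "c * t1 + (1 - c) * t2"] by (simp add: m_def)
    next
      case False
      then have m: "m \<in> {0<..1}"
        using range[of t1] range[of t2] by (auto simp: m_def min_def)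
      have "m \<le> u t1" "m \<le> u t2"
        by (simp_all add: m_def)
      then have "t1 \<in> {l m..r m}" "t2 \<in> {l m..r m}"
        using ge_iff[OF m] by blast+
      then have "c *\<^sub>R t1 + (1 - c) *\<^sub>R t2 \<in> {l m..r m}"
        using c by (intro convexD[OF convex_real_interval(5)]) auto
      then have "m \<le> u (c * t1 + (1 - c) * t2)"
        using ge_iff[OF m] by simp
      then show ?thesis
        by (simp add: m_def)
    qed
  qed
  have usc: "upper_semicontinuous u"
    unfolding upper_semicontinuous_def
  proof (intro allI impI)
    fix t c assume c: "u t < c"
    show "\<forall>\<^sub>F s in nhds t. u s < c"
    \<comment> \<open>For c in (0,1] the set where \<open>u\<close> is below c is, by
      \<open>ge_iff\<close>, the complement of a closed interval, hence open. For larger c it is the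
      whole line.\<close>
    proof (cases "c > 1")
      case True
      have "u s < c" for s
        using range[of s] True by auto
      then show ?thesis
        by simp
    next
      case False
      then have c': "c \<in> {0<..1}"
        using c range[of t] by auto
      have "\<forall>\<^sub>F s in nhds t. s \<in> - {l c..r c}"
        using c ge_iff[OF c', of t] by (intro eventually_nhds_in_open) auto
      then show ?thesis
        by eventually_elim (use ge_iff[OF c'] in \<open>auto simp: not_le[symmetric]\<close>)
    qed
  qed
  \<comment> \<open>Normality: the interval at level 1 is nonempty, so its left endpoint has value
    1.\<close>
  have "1 \<le> u (l 1)"
    using ge_iff[of 1 "l 1"] le[of 1] by simp
  then have "u (l 1) = 1"
    using range[of "l 1"] by simp
  moreover have "compact (closure {t. u t > 0})"
    by (simp add: cl_supp)
  ultimately have "u \<in> RF"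
    unfolding RF_def using range conv usc by blast
  moreover have "level u \<alpha> = {l \<alpha>..r \<alpha>}" if "\<alpha> \<in> {0..1}" for \<alpha>
    using that ge_iff[of \<alpha>] cl_supp by (auto simp: level_def)
  ultimately show ?thesis
    by (rule that)
qed

lemma RFc_of_continuous_endpoints:
  assumes g: "continuous_on {0..1} g"
    and mono: "\<And>\<alpha> \<beta>. \<lbrakk>0 \<le> \<alpha>; \<alpha> \<le> \<beta>; \<beta> \<le> 1\<rbrakk> \<Longrightarrow> fst (g \<alpha>) \<le> fst (g \<beta>) \<and> snd (g \<beta>) \<le> snd (g \<alpha>)"
    and le: "\<And>\<alpha>. \<alpha> \<in> {0..1} \<Longrightarrow> fst (g \<alpha>) \<le> snd (g \<alpha>)"
  obtains u where "u \<in> RFc" "\<And>\<alpha>. \<alpha> \<in> {0..1} \<Longrightarrow> endpoints u \<alpha> = g \<alpha>"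
proof -
  have cont: "continuous_on {0..1} (\<lambda>x. fst (g x))" "continuous_on {0..1} (\<lambda>x. snd (g x))"
    by (intro continuous_intros g)+
  have "mono_on {0..1} (\<lambda>x. fst (g x))"
    by (rule monotone_onI) (rule mono[THEN conjunct1], auto)
  moreover have "antimono_on {0..1} (\<lambda>x. snd (g x))"
    by (rule monotone_onI) (rule mono[THEN conjunct2], auto)
  ultimately obtain u where u: "u \<in> RF"
      "\<And>\<alpha>. \<alpha> \<in> {0..1} \<Longrightarrow> level u \<alpha> = {fst (g \<alpha>)..snd (g \<alpha>)}"
    using RF_of_continuous_intervals[OF cont _ _ le] by blast
  have eq: "endpoints u \<alpha> = g \<alpha>" if "\<alpha> \<in> {0..1}" for \<alpha>
    using u(2)[OF that] le[OF that] by (simp add: endpoints_def)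
  then have "continuous_on {0..1} (endpoints u)"
    using g by (simp cong: continuous_on_cong_simp)
  with u(1) have "u \<in> RFc"
    by (simp add: RFc_iff_continuous_endpoints)
  with eq show ?thesis
    using that by blast
qed

section \<open>Monotone endpoints, the fuzzy null set and uniform continuity in the level\<close>

lemma endpoints_mono:
  assumes "u \<in> RF" "0 \<le> \<alpha>" "\<alpha> \<le> \<beta>" "\<beta> \<le> 1"
  shows "fst (endpoints u \<alpha>) \<le> fst (endpoints u \<beta>)" "snd (endpoints u \<beta>) \<le> snd (endpoints u \<alpha>)"
proof -
  have "level u \<beta> \<subseteq> level u \<alpha>"
    using assms level_subset[of \<beta> u] by (cases "\<alpha> = 0") (auto simp: level_def)
  then show "fst (endpoints u \<alpha>) \<le> fst (endpoints u \<beta>)" "snd (endpoints u \<beta>) \<le> snd (endpoints u \<alpha>)"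
    using level_eq_interval[of u \<alpha>] level_eq_interval[of u \<beta>] assms by simp_all
qed

text \<open>With this, the distance to \<open>fuzzy_zero\<close> controls the norm of an endpoint
  curve.\<close>

lemma endpoints_fuzzy_zero: "\<alpha> \<in> {0..1} \<Longrightarrow> endpoints fuzzy_zero \<alpha> = 0"
proof -
  assume \<alpha>: "\<alpha> \<in> {0..1}"
  have "{t. fuzzy_zero t > 0} = {0}"
    by (auto simp: fuzzy_zero_def)
  moreover have "{t. fuzzy_zero t \<ge> \<alpha>} = {0}" if "\<alpha> \<noteq> 0"
    using \<alpha> that by (auto simp: fuzzy_zero_def split: if_splits)
  ultimately show ?thesis
    by (simp add: endpoints_def level_def zero_prod_def)
qed

lemma dH_level_le_D:
  "\<lbrakk>u \<in> RF; v \<in> RF; \<alpha> \<in> {0..1}\<rbrakk> \<Longrightarrow> dH (level u \<alpha>) (level v \<alpha>) \<le> D u v"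
  using D_le_iff[THEN iffD1, OF _ _ order_refl] by (rule bspec)

text \<open>Heine-Cantor for the endpoint curve on the compact interval [0,1]; passing back to
  \<open>dH\<close> costs no constant.\<close>

lemma RFc_uniformly_continuous_level:
  assumes u: "u \<in> RFc" and "\<epsilon> > 0"
  obtains \<delta> where "\<delta> > 0"
    "\<And>\<alpha> \<beta>. \<lbrakk>\<alpha> \<in> {0..1}; \<beta> \<in> {0..1}; \<bar>\<alpha> - \<beta>\<bar> < \<delta>\<rbrakk> \<Longrightarrow> dH (level u \<alpha>) (level u \<beta>) < \<epsilon>"
proof -
  have RF: "u \<in> RF" and "uniformly_continuous_on {0..1} (endpoints u)"
    using u by (auto simp: RFc_iff_continuous_endpoints intro: compact_uniformly_continuous)
  then obtain \<delta> where d: "\<delta> > 0" "\<And>\<alpha> \<beta>. \<lbrakk>\<alpha> \<in> {0..1}; \<beta> \<in> {0..1}; \<bar>\<alpha> - \<beta>\<bar> < \<delta>\<rbrakk>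
      \<Longrightarrow> dist (endpoints u \<alpha>) (endpoints u \<beta>) < \<epsilon>"
    using \<open>\<epsilon> > 0\<close> unfolding uniformly_continuous_on_def dist_real_def by metis
  show ?thesis
    by (rule that[OF d(1)]) (meson RF d(2) dH_level_le_dist le_less_trans)
qed

text \<open>Bounds for the single u yield only a non-strict bound for the supremum; using the
  hypothesis at half of \<epsilon> restores strictness.\<close>

lemma level_equicontinuousI:
  assumes "\<And>\<epsilon>. \<epsilon> > 0 \<Longrightarrow> \<exists>\<delta>>0. \<forall>\<alpha>\<in>{0..1}. \<forall>\<beta>\<in>{0..1}. \<bar>\<alpha> - \<beta>\<bar> < \<delta> \<longrightarrow>
    (\<forall>u\<in>A. dH (level u \<alpha>) (level u \<beta>) \<le> \<epsilon>)"
  shows "level_equicontinuous A"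
  unfolding level_equicontinuous_def
proof (intro allI impI)
  fix \<epsilon> :: real assume e: "\<epsilon> > 0"
  then obtain \<delta> where d: "\<delta> > 0" "\<forall>\<alpha>\<in>{0..1}. \<forall>\<beta>\<in>{0..1}. \<bar>\<alpha> - \<beta>\<bar> < \<delta> \<longrightarrow>
      (\<forall>u\<in>A. dH (level u \<alpha>) (level u \<beta>) \<le> \<epsilon> / 2)"
    using assms[OF half_gt_zero[OF e]] by blast
  have "(SUP u\<in>A. ennreal (dH (level u \<alpha>) (level u \<beta>))) < ennreal \<epsilon>"
    if "\<alpha> \<in> {0..1}" "\<beta> \<in> {0..1}" "\<bar>\<alpha> - \<beta>\<bar> < \<delta>" for \<alpha> \<beta>
  proof -
    have "(SUP u\<in>A. ennreal (dH (level u \<alpha>) (level u \<beta>))) \<le> ennreal (\<epsilon> / 2)"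
      using d(2) that by (intro SUP_least ennreal_leI) blast
    also have "\<dots> < ennreal \<epsilon>"
      using e by (simp add: ennreal_lessI)
    finally show ?thesis .
  qed
  then show "\<exists>\<delta>>0. \<forall>\<alpha>\<in>{0..1}. \<forall>\<beta>\<in>{0..1}. \<bar>\<alpha> - \<beta>\<bar> < \<delta> \<longrightarrow>
      (SUP u\<in>A. ennreal (dH (level u \<alpha>) (level u \<beta>))) < ennreal \<epsilon>"
    using d(1) by blast
qed

lemma level_equicontinuousD:
  assumes "level_equicontinuous A" "\<epsilon> > 0"
  obtains \<delta> where "\<delta> > 0" "\<And>\<alpha> \<beta> u. \<lbrakk>\<alpha> \<in> {0..1}; \<beta> \<in> {0..1}; \<bar>\<alpha> - \<beta>\<bar> < \<delta>; u \<in> A\<rbrakk>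
    \<Longrightarrow> dH (level u \<alpha>) (level u \<beta>) < \<epsilon>"
proof -
  obtain \<delta> where d: "\<delta> > 0" "\<forall>\<alpha>\<in>{0..1}. \<forall>\<beta>\<in>{0..1}. \<bar>\<alpha> - \<beta>\<bar> < \<delta> \<longrightarrow>
      (SUP u\<in>A. ennreal (dH (level u \<alpha>) (level u \<beta>))) < ennreal \<epsilon>"
    using assms unfolding level_equicontinuous_def by blast
  show ?thesis
  proof (rule that[OF d(1)])
    fix \<alpha> \<beta> u
    assume *: "\<alpha> \<in> {0..1}" "\<beta> \<in> {0..1}" "\<bar>\<alpha> - \<beta>\<bar> < \<delta>" and u: "u \<in> A"
    have "ennreal (dH (level u \<alpha>) (level u \<beta>)) \<le> (SUP u\<in>A. ennreal (dH (level u \<alpha>) (level u \<beta>)))"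
      using u by (rule SUP_upper)
    also have "\<dots> < ennreal \<epsilon>"
      using d(2) * by blast
    finally show "dH (level u \<alpha>) (level u \<beta>) < \<epsilon>"
      by (simp add: ennreal_less_iff dH_nonneg)
  qed
qed

section \<open>Necessity: consequences of total boundedness\<close>

text \<open>A totally bounded set is bounded and stays so when a point is added. Bounding all mutual
  distances in the enlarged set bounds in particular those to \<open>fuzzy_zero\<close>.\<close>

lemma totally_bounded_imp_fuzzy_bounded:
  assumes "Metric_space.mtotally_bounded RFc D A"
  shows "fuzzy_bounded A"
proof -
  interpret RFc: Metric_space RFc D
    by (rule Metric_space_RFc)
  have "RFc.mbounded (insert fuzzy_zero A)"
    using RFc.mtotally_bounded_imp_mbounded[OF assms]
    by (simp add: RFc.mbounded_insert fuzzy_zero_in_RFc)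
  then show ?thesis
    unfolding RFc.mbounded_alt_pos fuzzy_bounded_def by blast
qed

text \<open>A three-epsilon argument: finitely many centres, each uniformly continuous in the level,
  share one \<delta>, and every u in \<open>A\<close> is within a third of \<epsilon> of some centre
  at all levels simultaneously.\<close>

lemma totally_bounded_imp_level_equicontinuous:
  assumes tb: "Metric_space.mtotally_bounded RFc D A"
  shows "level_equicontinuous A"
proof (rule level_equicontinuousI)
  interpret RFc: Metric_space RFc D
    by (rule Metric_space_RFc)
  interpret Kc: Metric_space Kc dH
    by (rule Metric_space_Kc)
  have RF: "v \<in> RF" if "v \<in> RFc" for v
    using that by (simp add: RFc_def)
  fix \<epsilon> :: real assume "\<epsilon> > 0"
  then have e: "\<epsilon> / 3 > 0"
    by simp
  have AR: "A \<subseteq> RFc"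
    using tb RFc.mtotally_bounded_imp_subset by blast
  obtain K where K: "finite K" "K \<subseteq> A" "A \<subseteq> (\<Union>v\<in>K. RFc.mball v (\<epsilon> / 3))"
    using tb[unfolded RFc.mtotally_bounded_def, rule_format, OF e] by blast
  \<comment> \<open>Each centre admits all sufficiently small positive \<delta>. Phrased with the
    filter \<open>at_right 0\<close>, this passes to the finite set \<open>K\<close> without a
    minimum, even if \<open>K\<close> is empty.\<close>
  define near where "near v \<delta> \<longleftrightarrow> (\<forall>\<alpha>\<in>{0..1}. \<forall>\<beta>\<in>{0..1}. \<bar>\<alpha> - \<beta>\<bar> < \<delta> \<longrightarrow>
    dH (level v \<alpha>) (level v \<beta>) < \<epsilon> / 3)" for v \<delta>
  have "\<forall>\<^sub>F \<delta> in at_right 0. near v \<delta>" if v: "v \<in> K" for v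
  proof -
    have "v \<in> RFc"
      using v K(2) AR by blast
    from RFc_uniformly_continuous_level[OF this e]
    obtain \<delta> where d: "\<delta> > 0" "\<And>\<alpha> \<beta>. \<lbrakk>\<alpha> \<in> {0..1}; \<beta> \<in> {0..1}; \<bar>\<alpha> - \<beta>\<bar> < \<delta>\<rbrakk>
        \<Longrightarrow> dH (level v \<alpha>) (level v \<beta>) < \<epsilon> / 3"
      by blast
    have "near v \<eta>" if "\<eta> < \<delta>" for \<eta>
      unfolding near_def by (intro ballI impI d(2)) (use that in auto)
    with d(1) show ?thesis
      unfolding eventually_at_right_field by blast
  qed
  then have "\<forall>\<^sub>F \<delta> in at_right 0. \<forall>v\<in>K. near v \<delta>"
    using K(1) by (simp add: eventually_ball_finite)
  then obtain \<eta> where eta: "\<eta> > 0" "\<And>\<delta>. \<lbrakk>0 < \<delta>; \<delta> < \<eta>\<rbrakk> \<Longrightarrow> \<forall>v\<in>K. near v \<delta>"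
    unfolding eventually_at_right_field by blast
  obtain \<delta> where "0 < \<delta>" "\<delta> < \<eta>"
    using dense[OF eta(1)] by blast
  with eta(2) have d: "\<delta> > 0" "\<And>v. v \<in> K \<Longrightarrow> near v \<delta>"
    by blast+
  have "dH (level u \<alpha>) (level u \<beta>) \<le> \<epsilon>"
    if \<alpha>: "\<alpha> \<in> {0..1}" and \<beta>: "\<beta> \<in> {0..1}" and ab: "\<bar>\<alpha> - \<beta>\<bar> < \<delta>" and u: "u \<in> A" for \<alpha> \<beta> u
  proof -
    obtain v where v: "v \<in> K" "D v u < \<epsilon> / 3" and uv: "v \<in> RF" "u \<in> RF"
      using K(3) u RF by force
    have "dH (level v \<alpha>) (level u \<alpha>) < \<epsilon> / 3" "dH (level v \<beta>) (level u \<beta>) < \<epsilon> / 3"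
      using dH_level_le_D[OF uv \<alpha>] dH_level_le_D[OF uv \<beta>] v(2) by linarith+
    moreover have "dH (level v \<alpha>) (level v \<beta>) < \<epsilon> / 3"
      using d(2)[OF v(1)] \<alpha> \<beta> ab unfolding near_def by blast
    \<comment> \<open>The chain runs from u at \<alpha> through v at \<alpha> and v at \<beta> to u
      at \<beta>.\<close>
    moreover have "dH (level u \<alpha>) (level u \<beta>) \<le> dH (level u \<alpha>) (level v \<alpha>) + dH (level v \<alpha>) (level u \<beta>)"
      "dH (level v \<alpha>) (level u \<beta>) \<le> dH (level v \<alpha>) (level v \<beta>) + dH (level v \<beta>) (level u \<beta>)"
      using uv \<alpha> \<beta> by (auto intro!: Kc.triangle level_in_Kc)
    ultimately show ?thesis
      using dH_commute[of "level u \<alpha>" "level v \<alpha>"] by linarith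
  qed
  then show "\<exists>\<delta>>0. \<forall>\<alpha>\<in>{0..1}. \<forall>\<beta>\<in>{0..1}. \<bar>\<alpha> - \<beta>\<bar> < \<delta> \<longrightarrow>
      (\<forall>u\<in>A. dH (level u \<alpha>) (level u \<beta>) \<le> \<epsilon>)"
    using d(1) by blast
qed

section \<open>Sufficiency: limits of endpoint curves\<close>

text \<open>The order relations between endpoints are non-strict and survive pointwise limits, so g
  describes a nested family of intervals and is the endpoint curve of some u. Uniform convergence of
  the curves then gives convergence in \<open>D\<close>.\<close>

lemma RFc_uniform_limit_endpoints:
  fixes v :: "nat \<Rightarrow> real \<Rightarrow> real"
  assumes v: "\<And>n. v n \<in> RF" and g: "continuous_on {0..1} g"
    and lim: "\<And>e. 0 < e \<Longrightarrow> \<exists>N. \<forall>n \<alpha>. n \<ge> N \<and> \<alpha> \<in> {0..1} \<longrightarrow> norm (endpoints (v n) \<alpha> - g \<alpha>) < e"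
  obtains u where "u \<in> RFc" "\<And>e. 0 < e \<Longrightarrow> \<exists>N. \<forall>n\<ge>N. D (v n) u < e"
proof -
  have pt: "(\<lambda>n. endpoints (v n) \<alpha>) \<longlonglongrightarrow> g \<alpha>" if "\<alpha> \<in> {0..1}" for \<alpha>
    unfolding LIMSEQ_def dist_norm using lim that by meson
  note fst_lim = tendsto_fst[OF pt] and snd_lim = tendsto_snd[OF pt]
  obtain u where u: "u \<in> RFc" and eq: "\<And>\<alpha>. \<alpha> \<in> {0..1} \<Longrightarrow> endpoints u \<alpha> = g \<alpha>"
  proof (rule RFc_of_continuous_endpoints[OF g])
    show "fst (g \<alpha>) \<le> fst (g \<beta>) \<and> snd (g \<beta>) \<le> snd (g \<alpha>)" if "0 \<le> \<alpha>" "\<alpha> \<le> \<beta>" "\<beta> \<le> 1" for \<alpha> \<beta>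
      using that endpoints_mono[OF v that]
      by (intro conjI LIMSEQ_le[OF fst_lim fst_lim] LIMSEQ_le[OF snd_lim snd_lim]) auto
    show "fst (g \<alpha>) \<le> snd (g \<alpha>)" if "\<alpha> \<in> {0..1}" for \<alpha>
      using LIMSEQ_le[OF fst_lim[OF that] snd_lim[OF that]] level_eq_interval(2)[OF v that] by blast
  qed (rule that)
  have uRF: "u \<in> RF"
    using u by (simp add: RFc_def)
  show ?thesis
  proof (rule that[OF u])
    fix e :: real assume "0 < e"
    then obtain N where N: "\<And>n \<alpha>. \<lbrakk>n \<ge> N; \<alpha> \<in> {0..1}\<rbrakk> \<Longrightarrow> norm (endpoints (v n) \<alpha> - g \<alpha>) < e / 2"
      using lim[OF half_gt_zero[OF \<open>0 < e\<close>]] by blast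
    \<comment> \<open>\<open>D\<close> is a supremum over the levels, so strictness may be lost; e /
      2 leaves room for it.\<close>
    have "D (v n) u \<le> e / 2" if "n \<ge> N" for n
      unfolding D_le_iff[OF v uRF]
    proof
      fix \<alpha> :: real assume \<alpha>: "\<alpha> \<in> {0..1}"
      show "dH (level (v n) \<alpha>) (level u \<alpha>) \<le> e / 2"
        using dH_level_le_dist[OF v \<alpha> uRF \<alpha>, of n] N[OF that \<alpha>] by (simp add: dist_norm eq[OF \<alpha>])
    qed
    with \<open>0 < e\<close> have "D (v n) u < e" if "n \<ge> N" for n
      using that by fastforce
    then show "\<exists>N. \<forall>n\<ge>N. D (v n) u < e"
      by blast
  qed
qed

text \<open>Arzela-Ascoli for the endpoint curves: the two hypotheses supply the uniform bound and
  the equicontinuity, each up to the factor 2. The limit is found in \<open>RFc\<close> and may lie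
  outside \<open>A\<close>.\<close>

lemma bounded_equicontinuous_convergent_subsequence:
  fixes \<sigma> :: "nat \<Rightarrow> real \<Rightarrow> real"
  assumes A: "A \<subseteq> RFc" and b: "fuzzy_bounded A" and eq: "level_equicontinuous A"
    and \<sigma>: "range \<sigma> \<subseteq> A"
  obtains u k where "u \<in> RFc" "strict_mono (k :: nat \<Rightarrow> nat)"
    "\<And>e. 0 < e \<Longrightarrow> \<exists>N. \<forall>n\<ge>N. D (\<sigma> (k n)) u < e"
proof -
  have \<sigma>A: "\<sigma> n \<in> A" and \<sigma>RF: "\<sigma> n \<in> RF" for n
    using \<sigma> A by (auto simp: RFc_def)
  have zRF: "fuzzy_zero \<in> RF"
    using fuzzy_zero_in_RFc by (simp add: RFc_def)
  obtain M where M: "\<And>u. u \<in> A \<Longrightarrow> D u fuzzy_zero \<le> M"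
    using b by (auto simp: fuzzy_bounded_def)
  obtain g k where g: "continuous_on {0..1} g" and k: "strict_mono (k :: nat \<Rightarrow> nat)"
    and lim: "\<And>e. 0 < e \<Longrightarrow>
      \<exists>N. \<forall>n \<alpha>. n \<ge> N \<and> \<alpha> \<in> {0..1} \<longrightarrow> norm (endpoints (\<sigma> (k n)) \<alpha> - g \<alpha>) < e"
  \<comment> \<open>The norm of a curve is its distance to the curve of \<open>fuzzy_zero\<close>,
    which is constantly the origin; \<open>dist_le_dH_level\<close> turns the bound M on
    \<open>D\<close> into twice M.\<close>
  proof (rule Arzela_Ascoli[of "{0..1::real}" "\<lambda>n. endpoints (\<sigma> n)" "2 * M"])
    show "norm (endpoints (\<sigma> n) \<alpha>) \<le> 2 * M" if \<alpha>: "\<alpha> \<in> {0..1}" for n \<alpha>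
      using dist_le_dH_level[OF \<sigma>RF \<alpha> zRF \<alpha>, of n] dH_level_le_D[OF \<sigma>RF zRF \<alpha>, of n] M[OF \<sigma>A, of n]
      by (simp add: endpoints_fuzzy_zero[OF \<alpha>])
    show "\<exists>d>0. \<forall>n \<beta>. \<beta> \<in> {0..1} \<and> norm (\<alpha> - \<beta>) < d \<longrightarrow>
        norm (endpoints (\<sigma> n) \<alpha> - endpoints (\<sigma> n) \<beta>) < e"
      if \<alpha>: "\<alpha> \<in> {0..1}" and e: "0 < e" for \<alpha> e :: real
    proof -
      obtain \<delta> where d: "\<delta> > 0" "\<And>\<alpha> \<beta> u. \<lbrakk>\<alpha> \<in> {0..1}; \<beta> \<in> {0..1}; \<bar>\<alpha> - \<beta>\<bar> < \<delta>; u \<in> A\<rbrakk>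
          \<Longrightarrow> dH (level u \<alpha>) (level u \<beta>) < e / 2"
        using level_equicontinuousD[OF eq half_gt_zero[OF e]] by blast
      have "norm (endpoints (\<sigma> n) \<alpha> - endpoints (\<sigma> n) \<beta>) < e"
        if \<beta>: "\<beta> \<in> {0..1}" "norm (\<alpha> - \<beta>) < \<delta>" for n \<beta>
        using d(2)[OF \<alpha> \<beta>(1) _ \<sigma>A, of n] \<beta>(2) dist_le_dH_level[OF \<sigma>RF \<alpha> \<sigma>RF \<beta>(1), of n n]
        by (simp add: dist_norm)
      with d(1) show ?thesis
        by blast
    qed
  qed (rule compact_Icc that, assumption?)+
  show ?thesis
    using RFc_uniform_limit_endpoints[of "\<lambda>n. \<sigma> (k n)", OF \<sigma>RF g lim] that k by metis
qed

theorem theorem3p3: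
  fixes A :: "(real \<Rightarrow> real) set"
  assumes "A \<subseteq> RFc"
  shows "relatively_compact_in (Metric_space.mtopology RFc D) A \<longleftrightarrow>
           fuzzy_bounded A \<and> level_equicontinuous A"
proof -
  interpret RFc: Metric_space RFc D
    by (rule Metric_space_RFc)
  show ?thesis
  proof
    assume "relatively_compact_in RFc.mtopology A"
    then have "RFc.mtotally_bounded A"
      using RFc.compact_closure_of_imp_mtotally_bounded by (auto simp: relatively_compact_in_def)
    then show "fuzzy_bounded A \<and> level_equicontinuous A"
      using totally_bounded_imp_fuzzy_bounded totally_bounded_imp_level_equicontinuous by blast
  next
    assume bd: "fuzzy_bounded A \<and> level_equicontinuous A"
    \<comment> \<open>Limits are sought in \<open>RFc\<close> rather than in \<open>A\<close>:
      compactness of the closure amounts to infinite subsets of \<open>A\<close> having accumulation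
      points anywhere in the space.\<close>
    have "\<exists>l r. l \<in> RFc \<and> strict_mono r \<and> limitin RFc.mtopology (\<sigma> \<circ> r) l sequentially"
      if \<sigma>: "range \<sigma> \<subseteq> A" for \<sigma> :: "nat \<Rightarrow> real \<Rightarrow> real"
    proof -
      obtain u k where u: "u \<in> RFc" and k: "strict_mono (k :: nat \<Rightarrow> nat)"
        and lim: "\<And>e. 0 < e \<Longrightarrow> \<exists>N. \<forall>n\<ge>N. D (\<sigma> (k n)) u < e"
        using bounded_equicontinuous_convergent_subsequence[OF assms _ _ \<sigma>] bd by metis
      have "limitin RFc.mtopology (\<sigma> \<circ> k) u sequentially"
        unfolding RFc.limitin_metric eventually_sequentially
        using u lim \<sigma> assms by (fastforce simp: subset_iff)
      with u k show ?thesis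
        by blast
    qed
    then have "\<forall>T. T \<subseteq> A \<and> infinite T \<longrightarrow> RFc \<inter> RFc.mtopology derived_set_of T \<noteq> {}"
      using RFc.Bolzano_Weierstrass_property[OF assms assms] by blast
    then have "compactin RFc.mtopology (RFc.mtopology closure_of A)"
      unfolding RFc.compact_closure_of_eq_Bolzano_Weierstrass by blast
    with assms show "relatively_compact_in RFc.mtopology A"
      by (simp add: relatively_compact_in_def)
  qed
qed

end
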